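(* There exist a differentiable $N$-function $M:[0,\infty)\to[0,\infty)$ with constants $D_M\ge d_M\ge1$ satisfying $d_M\frac{M(\lambda)}{\lambda}\le M'(\lambda)\le D_M\frac{M(\lambda)}{\lambda}$ for every $\lambda>0$, a function $\varphi\in C^2(\mathbb{R}_+)$ with $\varphi'$ never vanishing, and a $C^1$ function $\omega:(0,\infty)\to[0,\infty)$, such that, with $\mu(dr)=e^{-\varphi(r)}dr$: (i) $b_1(\omega,\varphi,M)>0$ and $L(\omega,\varphi)<\infty$; in particular, there is a constant $C$ such that $$\int_{\mathbb{R}_+}M(\omega(r)|u(r)|)\,\mu(dr)\le C\int_{\mathbb{R}_+}M(|u'(r)|)\,\mu(dr)\qquad(\ast)$$ is satisfied for every $u\in\mathcal{R}^+_{(\omega,\varphi,M)}$. (ii) The triple does not satisfy the Bloom–Kerman condition; that is, there is no constant $B>0$ such that, with $G(\epsilon,y)=\int_y^\infty M(\epsilon\,\omega(x))e^{-\varphi(x)}dx$, $$\int_0^yM^*\left(\frac{G(\epsilon,y)}{B\,\epsilon\,e^{-\varphi(x)}}\right)e^{-\varphi(x)}dx\le G(\epsilon,y)<\infty\quad\text{for all }y>0,\ \epsilon>0.$$ (iii) The set $\mathcal{R}^{(0,+)}_{(\omega,\varphi,M)}:=\mathcal{R}^+_{(\omega,\varphi,M)}\cap\mathcal{H}$ is a proper subset of $\mathcal{H}$. Moreover, there is no constant $C$, independent of $u$, such that $(\ast)$ is satisfied for every $u\in\mathcal{H}$.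
   Context: $\mathbb{R}_+=(0,\infty)$. Functions in $W^{1,1}_{loc}(\mathbb{R}_+)$ are identified with their locally absolutely continuous representatives. An $N$-function is a continuous convex function $M:[0,\infty)\to[0,\infty)$ with $M(\lambda)/\lambda\to0$ as $\lambda\to0$ and $M(\lambda)/\lambda\to\infty$ as $\lambda\to\infty$. Its complementary function is $M^*(y)=\sup_{x>0}[xy-M(x)]$, $y\ge0$. $\mathcal{H}=\{u\in W^{1,1}_{loc}(\mathbb{R}_+):\lim_{r\to0}u(r)=0\}$ (the set of Hardy transforms). Let $F=\{r\in\mathbb{R}_+:\omega(r)\ne0,\ \omega'(r)\varphi'(r)>0\}$ and $G_0=\{r\in\mathbb{R}_+:\omega(r)\neq0,\ \omega'(r)\varphi'(r)<0\}$, with $\chi_A$ the indicator function of $A$ (an expression $f\chi_A$ is taken to be $0$ outside $A$). Define $$b_1(\omega,\varphi,M)=\inf_{r>0}\left(1+\frac{\varphi''(r)}{(\varphi'(r))^2}-\frac{\omega'(r)}{\omega(r)\varphi'(r)}\left[d_M\chi_{G_0}(r)+D_M\chi_F(r)\right]\right),\qquad L(\omega,\varphi)=\sup_{r>0}\frac{\omega(r)}{|\varphi'(r)|}.$$ For $u\in W^{1,1}_{loc}(\mathbb{R}_+)$ set $h^u(r)=\frac{1}{\varphi'(r)}M(\omega(r)|u(r)|)$. Then $\mathcal{R}^+_{(\omega,\varphi,M)}$ is the set of $u\in W^{1,1}_{loc}(\mathbb{R}_+)$ for which there exist sequences $s_n\to0$, $R_n\to\infty$ such that $\lim_{n\to\infty}\left(h^u(R_n)e^{-\varphi(R_n)}-h^u(s_n)e^{-\varphi(s_n)}\right)$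 exists in $[-\infty,\infty]$ and is $\ge0$. *)

theory Defs
  imports "HOL-Analysis.Analysis"
begin

text \<open>
  The half-line is the set \<open>{0<..}\<close> of reals. Functions on it (or on \<open>{0..}\<close>) are total functions
  on the reals of which only the values on that set matter.
\<close>

subsection \<open>N-functions\<close>

definition N_function :: "(real \<Rightarrow> real) \<Rightarrow> bool" where
  "N_function M \<longleftrightarrow>
     (\<forall>x\<ge>0. 0 \<le> M x) \<and> continuous_on {0..} M \<and> convex_on {0..} M \<and>
     ((\<lambda>x. M x / x) \<longlongrightarrow> 0) (at_right 0) \<and> filterlim (\<lambda>x. M x / x) at_top at_top"

definition complementary :: "(real \<Rightarrow> real) \<Rightarrow> real \<Rightarrow> ereal" where
  "complementary M y = (SUP x\<in>{0<..}. ereal (x * y - M x))"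

subsection \<open>The local Sobolev space on the half-line\<close>

definition locally_integrable :: "(real \<Rightarrow> real) \<Rightarrow> bool" where
  "locally_integrable f \<longleftrightarrow> (\<forall>a b. 0 < a \<longrightarrow> a < b \<longrightarrow> set_integrable lborel {a..b} f)"

definition test_function :: "(real \<Rightarrow> real) \<Rightarrow> bool" where
  "test_function \<psi> \<longleftrightarrow>
     (\<forall>n x. ((deriv ^^ n) \<psi>) differentiable (at x)) \<and>
     (\<exists>a b. 0 < a \<and> a < b \<and> (\<forall>x. x \<notin> {a..b} \<longrightarrow> \<psi> x = 0))"

definition weak_derivative :: "(real \<Rightarrow> real) \<Rightarrow> (real \<Rightarrow> real) \<Rightarrow> bool" where
  "weak_derivative u g \<longleftrightarrow>
     locally_integrable u \<and> locally_integrable g \<and>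
     (\<forall>\<psi>. test_function \<psi> \<longrightarrow>
        (LBINT r:{0<..}. u r * deriv \<psi> r) = - (LBINT r:{0<..}. g r * \<psi> r))"

definition abs_continuous_on :: "real \<Rightarrow> real \<Rightarrow> (real \<Rightarrow> real) \<Rightarrow> bool" where
  "abs_continuous_on a b f \<longleftrightarrow>
     (\<forall>\<epsilon>>0. \<exists>\<delta>>0. \<forall>(n::nat) \<alpha> \<beta>.
        (\<forall>i<n. a \<le> \<alpha> i \<and> \<alpha> i \<le> \<beta> i \<and> \<beta> i \<le> b) \<longrightarrow>
        disjoint_family_on (\<lambda>i. {\<alpha> i<..<\<beta> i}) {..<n} \<longrightarrow>
        (\<Sum>i<n. \<beta> i - \<alpha> i) < \<delta> \<longrightarrow>
        (\<Sum>i<n. \<bar>f (\<beta> i) - f (\<alpha> i)\<bar>) < \<epsilon>)"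

text \<open>
  Each class in the Sobolev space is represented by its locally absolutely continuous member. The
  derivative stays a relation: a weak derivative is determined only up to a null set.
\<close>

definition W11_loc :: "(real \<Rightarrow> real) set" where
  "W11_loc = {u. (\<exists>g. weak_derivative u g) \<and>
                 (\<forall>a b. 0 < a \<longrightarrow> a < b \<longrightarrow> abs_continuous_on a b u)}"

definition Hardy_transforms :: "(real \<Rightarrow> real) set" where
  "Hardy_transforms = {u \<in> W11_loc. (u \<longlongrightarrow> 0) (at_right 0)}"

subsection \<open>Quantities attached to the triple\<close>

definition C2_half_line :: "(real \<Rightarrow> real) \<Rightarrow> bool" where
  "C2_half_line \<phi> \<longleftrightarrow>
     \<phi> C1_differentiable_on {0<..} \<and> deriv \<phi> C1_differentiable_on {0<..}"

definition F_set :: "(real \<Rightarrow> real) \<Rightarrow> (real \<Rightarrow> real) \<Rightarrow> real set" where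
  "F_set \<omega> \<phi> = {r. 0 < r \<and> \<omega> r \<noteq> 0 \<and> deriv \<omega> r * deriv \<phi> r > 0}"

definition G0_set :: "(real \<Rightarrow> real) \<Rightarrow> (real \<Rightarrow> real) \<Rightarrow> real set" where
  "G0_set \<omega> \<phi> = {r. 0 < r \<and> \<omega> r \<noteq> 0 \<and> deriv \<omega> r * deriv \<phi> r < 0}"

text \<open>
  The function \<open>M\<close> enters \<open>b1\<close> only through the constants \<open>d\<close> and \<open>D\<close>. Where \<open>\<omega>\<close> vanishes both
  indicators are zero, so the last summand is zero there.
\<close>

definition b1 :: "(real \<Rightarrow> real) \<Rightarrow> (real \<Rightarrow> real) \<Rightarrow> real \<Rightarrow> real \<Rightarrow> ereal" where
  "b1 \<omega> \<phi> d D =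
     (INF r\<in>{0<..}. ereal
        (1 + deriv (deriv \<phi>) r / (deriv \<phi> r)\<^sup>2
           - deriv \<omega> r / (\<omega> r * deriv \<phi> r) *
             (d * indicator (G0_set \<omega> \<phi>) r + D * indicator (F_set \<omega> \<phi>) r)))"

definition L_const :: "(real \<Rightarrow> real) \<Rightarrow> (real \<Rightarrow> real) \<Rightarrow> ereal" where
  "L_const \<omega> \<phi> = (SUP r\<in>{0<..}. ereal (\<omega> r / \<bar>deriv \<phi> r\<bar>))"

definition h_fun ::
  "(real \<Rightarrow> real) \<Rightarrow> (real \<Rightarrow> real) \<Rightarrow> (real \<Rightarrow> real) \<Rightarrow> (real \<Rightarrow> real) \<Rightarrow> real \<Rightarrow> real" where
  "h_fun \<omega> \<phi> M u r = 1 / deriv \<phi> r * M (\<omega> r * \<bar>u r\<bar>)"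

definition R_plus ::
  "(real \<Rightarrow> real) \<Rightarrow> (real \<Rightarrow> real) \<Rightarrow> (real \<Rightarrow> real) \<Rightarrow> (real \<Rightarrow> real) set" where
  "R_plus \<omega> \<phi> M =
     {u \<in> W11_loc. \<exists>(s :: nat \<Rightarrow> real) (R :: nat \<Rightarrow> real) (l :: ereal).
        (\<forall>n. 0 < s n) \<and> s \<longlonglongrightarrow> 0 \<and> (\<forall>n. 0 < R n) \<and> filterlim R at_top sequentially \<and>
        (\<lambda>n. ereal (h_fun \<omega> \<phi> M u (R n) * exp (- \<phi> (R n))
                   - h_fun \<omega> \<phi> M u (s n) * exp (- \<phi> (s n)))) \<longlonglongrightarrow> l \<and>
        0 \<le> l}"

definition R_zero_plus ::
  "(real \<Rightarrow> real) \<Rightarrow> (real \<Rightarrow> real) \<Rightarrow> (real \<Rightarrow> real) \<Rightarrow> (real \<Rightarrow> real) set" where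
  "R_zero_plus \<omega> \<phi> M = R_plus \<omega> \<phi> M \<inter> Hardy_transforms"

subsection \<open>The Hardy inequality and the Bloom--Kerman condition\<close>

definition Hardy_inequality_on ::
  "(real \<Rightarrow> real) set \<Rightarrow> (real \<Rightarrow> real) \<Rightarrow> (real \<Rightarrow> real) \<Rightarrow> (real \<Rightarrow> real) \<Rightarrow> real \<Rightarrow> bool" where
  "Hardy_inequality_on S \<omega> \<phi> M C \<longleftrightarrow>
     (\<forall>u\<in>S. \<forall>u'. weak_derivative u u' \<longrightarrow>
        (\<integral>\<^sup>+r\<in>{0<..}. ennreal (M (\<omega> r * \<bar>u r\<bar>) * exp (- \<phi> r)) \<partial>lborel)
        \<le> ennreal C * (\<integral>\<^sup>+r\<in>{0<..}. ennreal (M \<bar>u' r\<bar> * exp (- \<phi> r)) \<partial>lborel))"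

definition G_fun ::
  "(real \<Rightarrow> real) \<Rightarrow> (real \<Rightarrow> real) \<Rightarrow> (real \<Rightarrow> real) \<Rightarrow> real \<Rightarrow> real \<Rightarrow> ennreal" where
  "G_fun \<omega> \<phi> M \<epsilon> y = (\<integral>\<^sup>+x\<in>{y<..}. ennreal (M (\<epsilon> * \<omega> x) * exp (- \<phi> x)) \<partial>lborel)"

text \<open>
  \<open>e2ennreal\<close> loses nothing: for an N-function the complementary function is nonnegative on
  nonnegative arguments. \<open>enn2real\<close> is harmless because of the conjunct \<open>G_fun \<omega> \<phi> M \<epsilon> y < \<infinity>\<close>.
\<close>

definition Bloom_Kerman ::
  "(real \<Rightarrow> real) \<Rightarrow> (real \<Rightarrow> real) \<Rightarrow> (real \<Rightarrow> real) \<Rightarrow> real \<Rightarrow> bool" where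
  "Bloom_Kerman \<omega> \<phi> M B \<longleftrightarrow>
     (\<forall>y>0. \<forall>\<epsilon>>0.
        (\<integral>\<^sup>+x\<in>{0<..<y}.
            e2ennreal (complementary M (enn2real (G_fun \<omega> \<phi> M \<epsilon> y) / (B * \<epsilon> * exp (- \<phi> x))))
            * ennreal (exp (- \<phi> x)) \<partial>lborel) \<le> G_fun \<omega> \<phi> M \<epsilon> y
        \<and> G_fun \<omega> \<phi> M \<epsilon> y < \<infinity>)"

end

theory Submission
  imports Defs
begin

text \<open>
  The witness is \<open>M x = x\<^sup>2\<close>, \<open>\<phi> r = - r\<close> and \<open>\<omega> = 1\<close>, that is, the quadratic Hardy inequality
  \<open>\<integral> u\<^sup>2 e\<^sup>r dr \<le> 4 \<integral> (u')\<^sup>2 e\<^sup>r dr\<close> for the exponentially growing weight on the half-line. Since \<open>\<phi>\<close>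
  is linear and \<open>\<omega>\<close> is constant, both \<open>b1\<close> and \<open>L_const\<close> equal 1.

  Because the weight grows, the inequality needs control of \<open>u\<close> at infinity, whereas membership in
  the set of Hardy transforms and the Bloom--Kerman condition control \<open>u\<close> at the origin. The
  function \<open>1 - exp (- r)\<close> vanishes at the origin and has \<open>\<integral> (u')\<^sup>2 e\<^sup>r dr = 1\<close>, but it tends to 1 at
  infinity, so its left-hand side is infinite: there is no inequality on the Hardy transforms.
  For the same reason \<open>G_fun\<close> is infinite, and the Bloom--Kerman condition fails.

  For the positive part, let \<open>u\<close> lie in \<open>R_plus\<close> and have finite energy \<open>\<integral> (u')\<^sup>2 e\<^sup>r dr\<close>. Then \<open>u'\<close> is
  integrable, so \<open>u\<close> is bounded near the origin, and the sign condition at the two ends bounds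
  \<open>(u (R n))\<^sup>2 exp (R n)\<close>; hence \<open>u (R n)\<close> tends to 0 (\<open>R_plus_vanishing_at_infinity\<close>). Consequently
  \<open>\<bar>u r\<bar> \<le> \<integral>\<^sub>r\<^sup>\<infinity> \<bar>u'\<bar>\<close>, and the Hardy inequality for tail integrals (\<open>Hardy_exponential_weight\<close>) follows
  from the Cauchy--Schwarz inequality with the splitting
  \<open>\<bar>u' t\<bar> = exp (- t / 4) * (\<bar>u' t\<bar> * exp (t / 4))\<close> and Tonelli's theorem.

  What links \<open>u\<close> to its weak derivative \<open>g\<close> is the formula \<open>u b - u a = \<integral>\<^sub>a\<^sup>b g\<close> for continuous \<open>u\<close>
  (\<open>weak_derivative_FTC\<close>). It is obtained by testing against smooth functions that approximate the
  indicator of \<open>{a<..b}\<close>; these are built from \<open>exp (- 1 / x)\<close>.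
\<close>

section \<open>Smooth steps\<close>

text \<open>
  These are the functions that occur in the derivatives of \<open>exp (- 1 / x)\<close>, extended by zero. Their
  linear span is closed under differentiation, and so smoothness reduces to a single computation
  of a derivative.
\<close>

definition flat :: "nat \<Rightarrow> real \<Rightarrow> real" where
  "flat n x = (if 0 < x then (1 / x) ^ n * exp (- (1 / x)) else 0)"

lemma flat_tendsto_0: "(flat n \<longlongrightarrow> 0) (at_right 0)"
proof -
  have "((\<lambda>x. (1 / x) ^ n / exp (1 / x)) \<longlongrightarrow> (0::real)) (at_right 0)"
    using filterlim_compose[OF tendsto_power_div_exp_0[of n] filterlim_inverse_at_top_right]
    by (simp add: inverse_eq_divide)
  then show ?thesis
    by (rule Lim_transform_eventually)
       (auto simp: flat_def exp_minus field_simps eventually_at_filter)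
qed

lemma DERIV_flat:
  "(flat n has_real_derivative flat (n + 2) x - real n * flat (n + 1) x) (at x)"
proof -
  consider "x > 0" | "x < 0" | "x = 0" by linarith
  then show ?thesis
  proof cases
    case 1
    let ?y = "1 / x"
    have "((\<lambda>y. y ^ n * exp (- y)) has_real_derivative
        real n * ?y ^ (n - 1) * exp (- ?y) - ?y ^ n * exp (- ?y)) (at ?y)"
      by (auto intro!: derivative_eq_intros)
    moreover have "((\<lambda>x. 1 / x) has_real_derivative - (?y\<^sup>2)) (at x)"
      using 1 by (auto intro!: derivative_eq_intros simp: power2_eq_square)
    ultimately have "((\<lambda>x. (1 / x) ^ n * exp (- (1 / x))) has_real_derivative
        (real n * ?y ^ (n - 1) * exp (- ?y) - ?y ^ n * exp (- ?y)) * - (?y\<^sup>2)) (at x)"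
      by (rule DERIV_chain2[where g = "\<lambda>x. 1 / x"])
    also have "(real n * ?y ^ (n - 1) * exp (- ?y) - ?y ^ n * exp (- ?y)) * - (?y\<^sup>2)
        = flat (n + 2) x - real n * flat (n + 1) x"
      using 1 unfolding flat_def by (cases n) (simp_all add: algebra_simps add_divide_distrib power2_eq_square del: power_one_over)
    finally have "((\<lambda>x. (1 / x) ^ n * exp (- (1 / x))) has_real_derivative
        flat (n + 2) x - real n * flat (n + 1) x) (at x)" .
    then show ?thesis
      by (rule has_field_derivative_transform_within_open[where S = "{0<..}"])
         (use 1 in \<open>auto simp: flat_def\<close>)
  next
    case 2
    have "((\<lambda>x. 0) has_real_derivative flat (n + 2) x - real n * flat (n + 1) x) (at x)"
      using 2 by (simp add: flat_def)
    then show ?thesis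
      by (rule has_field_derivative_transform_within_open[where S = "{..<0}"])
         (use 2 in \<open>auto simp: flat_def\<close>)
  next
    case 3
    \<comment> \<open>The difference quotient of \<open>flat n\<close> at 0 is \<open>flat (Suc n)\<close>.\<close>
    have "(flat (Suc n) \<longlongrightarrow> 0) (at_left 0)"
      by (rule tendsto_eventually) (auto simp: flat_def eventually_at_filter)
    then have "(flat (Suc n) \<longlongrightarrow> 0) (at 0)"
      using flat_tendsto_0[of "Suc n"] by (simp add: filterlim_at_split)
    then have "((\<lambda>h. flat n h / h) \<longlongrightarrow> 0) (at 0)"
      by (rule Lim_transform_eventually) (auto simp: flat_def eventually_at_filter)
    then show ?thesis
      using 3 by (simp add: DERIV_def flat_def)
  qed
qed

text \<open>
  A class of functions that contains the cut-offs below and is closed under differentiation.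
  Closure under one derivative gives all higher derivatives by induction.
\<close>

inductive flat_algebra :: "(real \<Rightarrow> real) \<Rightarrow> bool" where
  flat: "flat_algebra (\<lambda>x. flat n (c * x + d))"
| const: "flat_algebra (\<lambda>x. c)"
| add: "flat_algebra f \<Longrightarrow> flat_algebra g \<Longrightarrow> flat_algebra (\<lambda>x. f x + g x)"
| mult: "flat_algebra f \<Longrightarrow> flat_algebra g \<Longrightarrow> flat_algebra (\<lambda>x. f x * g x)"
| inverse: "flat_algebra f \<Longrightarrow> (\<And>x. f x \<noteq> 0) \<Longrightarrow> flat_algebra (\<lambda>x. inverse (f x))"

lemma flat_algebra_DERIV:
  "flat_algebra f \<Longrightarrow> \<exists>f'. flat_algebra f' \<and> (\<forall>x. (f has_real_derivative f' x) (at x))"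
proof (induction rule: flat_algebra.induct)
  case (flat n c d)
  let ?D = "\<lambda>x. (flat (n + 2) (c * x + d) + (- real n) * flat (n + 1) (c * x + d)) * c"
  have "flat_algebra ?D"
    by (intro flat_algebra.intros)
  moreover have "((\<lambda>x. flat n (c * x + d)) has_real_derivative ?D x) (at x)" for x
    by (rule DERIV_chain2[where f = "flat n" and g = "\<lambda>x. c * x + d"])
       (use DERIV_flat[of n "c * x + d"] in \<open>auto intro!: derivative_eq_intros\<close>)
  ultimately show ?case by blast
next
  case (const c)
  show ?case by (intro exI[of _ "\<lambda>x. 0"]) (auto intro: flat_algebra.const)
next
  case (add f g)
  then obtain f' g' where "flat_algebra f'" "flat_algebra g'"
    and D: "\<And>x. (f has_real_derivative f' x) (at x)" "\<And>x. (g has_real_derivative g' x) (at x)"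
    by blast
  then show ?case
    by (intro exI[of _ "\<lambda>x. f' x + g' x"]) (auto intro: flat_algebra.add DERIV_add)
next
  case (mult f g)
  then obtain f' g' where "flat_algebra f'" "flat_algebra g'"
    and D: "\<And>x. (f has_real_derivative f' x) (at x)" "\<And>x. (g has_real_derivative g' x) (at x)"
    by blast
  with mult.hyps show ?case
    by (intro exI[of _ "\<lambda>x. f' x * g x + g' x * f x"])
       (auto intro!: flat_algebra.add flat_algebra.mult DERIV_mult)
next
  case (inverse f)
  then obtain f' where "flat_algebra f'" and D: "\<And>x. (f has_real_derivative f' x) (at x)"
    by blast
  with inverse.hyps have "flat_algebra (\<lambda>x. (- 1) * (inverse (f x) * (f' x * inverse (f x))))"
    by (intro flat_algebra.intros)
  moreover have "((\<lambda>x. inverse (f x)) has_real_derivative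
      (- 1) * (inverse (f x) * (f' x * inverse (f x)))) (at x)" for x
    using DERIV_inverse'[OF D inverse.hyps(2)] by (simp add: mult.assoc)
  ultimately show ?case by blast
qed

lemma flat_algebra_deriv:
  assumes "flat_algebra f"
  shows "flat_algebra (deriv f)" and "(f has_real_derivative deriv f x) (at x)"
proof -
  obtain f' where f': "flat_algebra f'" "\<And>x. (f has_real_derivative f' x) (at x)"
    using flat_algebra_DERIV[OF assms] by blast
  then have "deriv f = f'"
    by (auto intro: DERIV_imp_deriv)
  with f' show "flat_algebra (deriv f)" "(f has_real_derivative deriv f x) (at x)" by auto
qed

lemma flat_algebra_smooth:
  assumes "flat_algebra f"
  shows "((deriv ^^ n) f) differentiable (at x)"
proof -
  have "flat_algebra ((deriv ^^ n) f)"
    using assms by (induction n) (auto intro: flat_algebra_deriv)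
  then show ?thesis
    using flat_algebra_deriv(2) real_differentiable_def by blast
qed

definition smooth_step :: "real \<Rightarrow> real" where
  "smooth_step x = flat 0 x / (flat 0 x + flat 0 (1 - x))"

lemma flat_sum_pos: "0 < flat 0 x + flat 0 (1 - x)"
  by (auto simp: flat_def add_pos_pos)

lemma smooth_step_0: "x \<le> 0 \<Longrightarrow> smooth_step x = 0"
  and smooth_step_1: "1 \<le> x \<Longrightarrow> smooth_step x = 1"
  by (auto simp: smooth_step_def flat_def)

lemma smooth_step_bounds: "0 \<le> smooth_step x" "smooth_step x \<le> 1"
proof -
  have "0 \<le> flat 0 x" "0 \<le> flat 0 (1 - x)" by (auto simp: flat_def)
  then show "0 \<le> smooth_step x" "smooth_step x \<le> 1"
    using flat_sum_pos[of x] by (auto simp: smooth_step_def)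
qed

lemma flat_algebra_smooth_step: "flat_algebra (\<lambda>x. smooth_step (c * x + d))"
proof -
  have eq: "1 - (c * x + d) = (- c) * x + (1 - d)" for x by simp
  have "flat_algebra (\<lambda>x. flat 0 (c * x + d) * inverse (flat 0 (c * x + d) + flat 0 ((- c) * x + (1 - d))))"
    using flat_sum_pos[of "c * x + d" for x, unfolded eq]
    by (intro flat_algebra.intros) (metis less_irrefl)
  then show ?thesis
    unfolding smooth_step_def eq divide_inverse .
qed

lemma DERIV_smooth_step: "(smooth_step has_real_derivative deriv smooth_step x) (at x)"
  and continuous_on_deriv_smooth_step: "continuous_on A (deriv smooth_step)"
proof -
  have *: "flat_algebra smooth_step"
    using flat_algebra_smooth_step[of 1 0] by simp
  show "(smooth_step has_real_derivative deriv smooth_step x) (at x)"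
    by (rule flat_algebra_deriv[OF *])
  show "continuous_on A (deriv smooth_step)"
    using flat_algebra_deriv(2)[OF flat_algebra_deriv(1)[OF *]]
    by (intro continuous_at_imp_continuous_on) (auto dest: DERIV_isCont)
qed

lemma deriv_smooth_step_outside:
  assumes "x \<notin> {0..1}"
  shows "deriv smooth_step x = 0"
proof -
  have "(smooth_step has_real_derivative 0) (at x)"
  proof (cases "x < 0")
    case True
    show ?thesis
      by (rule has_field_derivative_transform_within_open[where f = "\<lambda>_. 0" and S = "{..<0}"])
         (use True in \<open>auto simp: smooth_step_0\<close>)
  next
    case False
    show ?thesis
      by (rule has_field_derivative_transform_within_open[where f = "\<lambda>_. 1" and S = "{1<..}"])
         (use False assms in \<open>auto simp: smooth_step_1\<close>)
  qed
  then show ?thesis by (rule DERIV_imp_deriv)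
qed

lemma integral_deriv_smooth_step: "(LBINT t:{0..1}. deriv smooth_step t) = 1"
proof -
  have "(LBINT t:{0..1}. deriv smooth_step t) = smooth_step 1 - smooth_step 0"
    unfolding set_lebesgue_integral_def
    by (rule integral_FTC_atLeastAtMost)
       (auto intro!: continuous_on_deriv_smooth_step has_field_derivative_at_within
          DERIV_smooth_step simp flip: has_real_derivative_iff_has_vector_derivative)
  then show ?thesis by (simp add: smooth_step_0 smooth_step_1)
qed

section \<open>The fundamental theorem of calculus for weak derivatives\<close>

lemma test_function_step_difference:
  assumes "0 < c" "0 < a" "a < b"
  shows "test_function (\<lambda>x. smooth_step (c * (x - a)) - smooth_step (c * (x - b)))"
proof -
  have eq: "(\<lambda>x. smooth_step (c * (x - a)) - smooth_step (c * (x - b)))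
      = (\<lambda>x. smooth_step (c * x + (- (c * a))) + (- 1) * smooth_step (c * x + (- (c * b))))"
    by (simp add: algebra_simps)
  have "flat_algebra (\<lambda>x. smooth_step (c * (x - a)) - smooth_step (c * (x - b)))"
    unfolding eq by (intro flat_algebra.add flat_algebra.mult flat_algebra.const flat_algebra_smooth_step)
  moreover have "smooth_step (c * (x - a)) - smooth_step (c * (x - b)) = 0"
    if "x \<notin> {a..b + 1 / c}" for x
  proof -
    from that consider "x < a" | "b + 1 / c < x" by fastforce
    then show ?thesis
    proof cases
      case 1
      with assms have "c * (x - a) \<le> 0" "c * (x - b) \<le> 0"
        by (auto simp: mult_le_0_iff)
      then show ?thesis by (simp add: smooth_step_0)
    next
      case 2
      with assms have "1 \<le> c * (x - b)" by (simp add: field_simps)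
      moreover from this have "1 \<le> c * (x - a)"
        using assms mult_left_mono[of "x - b" "x - a" c] by linarith
      ultimately show ?thesis by (simp add: smooth_step_1)
    qed
  qed
  moreover have "a < b + 1 / c" using assms by (intro pos_add_strict[of "1 / c" a b, unfolded add.commute[of "1 / c"]]) auto
  ultimately show ?thesis
    unfolding test_function_def using assms(2) flat_algebra_smooth by blast
qed

lemma smooth_step_scaled_tendsto:
  "(\<lambda>n. smooth_step (real (Suc n) * (x - a))) \<longlonglongrightarrow> indicator {a<..} x"
proof (cases "x \<le> a")
  case True
  then have "smooth_step (real (Suc n) * (x - a)) = 0" for n
    by (intro smooth_step_0) (simp add: mult_le_0_iff)
  with True show ?thesis by simp
next
  case False
  have "\<forall>\<^sub>F n in sequentially. smooth_step (real (Suc n) * (x - a)) = 1"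
  proof -
    obtain N where N: "1 / (x - a) < real N" using reals_Archimedean2 by blast
    have "smooth_step (real (Suc n) * (x - a)) = 1" if "N \<le> n" for n
    proof (rule smooth_step_1)
      have "1 / (x - a) \<le> real (Suc n)" using N that by simp
      then show "1 \<le> real (Suc n) * (x - a)" using False by (simp add: field_simps)
    qed
    then show ?thesis unfolding eventually_sequentially by blast
  qed
  with False show ?thesis by (simp add: tendsto_eventually)
qed

text \<open>
  The functions \<open>x \<mapsto> c h(c (x - a))\<close> with \<open>h = deriv smooth_step\<close> have integral 1 and are
  supported in \<open>[a, a + 1/c]\<close>, so they form an approximate identity at \<open>a\<close>. After the substitution
  \<open>x = a + t / c\<close> this is dominated convergence on \<open>[0, 1]\<close>.
\<close>

lemma integral_deriv_scaled_step:
  fixes u :: "real \<Rightarrow> real"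
  assumes u: "continuous_on {0<..} u" and a: "0 < a"
  shows "integrable lborel (\<lambda>x. indicator {0<..} x * (u x * (real (Suc n) * deriv smooth_step (real (Suc n) * (x - a)))))"
      (is "integrable lborel (?F n)")
    and "(\<lambda>n. LBINT x. indicator {0<..} x * (u x * (real (Suc n) * deriv smooth_step (real (Suc n) * (x - a)))))
      \<longlonglongrightarrow> u a"
proof -
  let ?h = "deriv smooth_step"
  let ?G = "\<lambda>n t. indicator {0..1} t * (u (a + t / real (Suc n)) * ?h t)"
  have aff: "?F n (a + (1 / real (Suc n)) * t) = real (Suc n) * ?G n t" for n t
  proof (cases "t \<in> {0..1}")
    case True
    then have "0 < a + (1 / real (Suc n)) * t" using a by (intro add_pos_nonneg) auto
    then show ?thesis using True by (simp add: indicator_def mult_ac)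
  next
    case False
    have "real (Suc n) * (a + (1 / real (Suc n)) * t - a) = t"
      by (simp del: of_nat_Suc)
    with False show ?thesis by (simp add: deriv_smooth_step_outside del: of_nat_Suc)
  qed
  have cont_shift: "continuous_on {0..1} (\<lambda>t. u (a + t / real (Suc n)))" for n
    using a by (intro continuous_on_compose2[OF u] continuous_intros) (auto intro!: add_pos_nonneg)
  have int_G: "integrable lborel (?G n)" for n
    using borel_integrable_atLeastAtMost'[OF continuous_on_mult[OF cont_shift continuous_on_deriv_smooth_step]]
    unfolding set_integrable_def by simp
  show "integrable lborel (?F n)"
  proof -
    have "integrable lborel (\<lambda>t. ?F n (a + (1 / real (Suc n)) * t))"
      unfolding aff using int_G by (rule integrable_mult_right)
    then show ?thesis
      by (subst (asm) lborel_integrable_real_affine_iff) auto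
  qed
  have eq: "integral\<^sup>L lborel (?F n) = integral\<^sup>L lborel (?G n)" for n
    using lborel_integral_real_affine[of "1 / real (Suc n)" "?F n" a] unfolding aff
    by simp
  have "continuous_on {a..a + 1} u" using u a by (auto intro: continuous_on_subset)
  then obtain K where K: "\<And>x. x \<in> {a..a + 1} \<Longrightarrow> \<bar>u x\<bar> \<le> K"
    using compact_imp_bounded[OF compact_continuous_image[OF _ compact_Icc]]
    by (fastforce simp: bounded_iff)
  have "(\<lambda>n. integral\<^sup>L lborel (?G n)) \<longlonglongrightarrow> (LBINT t. indicator {0..1} t * (u a * ?h t))"
  proof (rule integral_dominated_convergence)
    show "integrable lborel (\<lambda>t. indicator {0..1} t * (K * \<bar>?h t\<bar>))"
      using borel_integrable_atLeastAtMost'[of 0 1 "\<lambda>t. K * \<bar>?h t\<bar>"]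
      unfolding set_integrable_def
      by (simp add: continuous_on_mult continuous_on_rabs continuous_on_deriv_smooth_step)
    show "AE t in lborel. (\<lambda>n. ?G n t) \<longlonglongrightarrow> indicator {0..1} t * (u a * ?h t)"
    proof (intro AE_I2 tendsto_mult tendsto_const)
      fix t :: real
      have "isCont u a" using u a by (simp add: continuous_on_eq_continuous_at)
      moreover have "(\<lambda>n. a + t / real (Suc n)) \<longlonglongrightarrow> a + t * 0"
        unfolding divide_inverse by (intro tendsto_intros LIMSEQ_inverse_real_of_nat)
      ultimately show "(\<lambda>n. u (a + t / real (Suc n))) \<longlonglongrightarrow> u a"
        by (intro isCont_tendsto_compose[of a u]) auto
    qed
    show "AE t in lborel. norm (?G n t) \<le> indicator {0..1} t * (K * \<bar>?h t\<bar>)" for n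
    proof (rule AE_I2)
      fix t
      have "\<bar>u (a + t / real (Suc n))\<bar> \<le> K" if "t \<in> {0..1}"
        using that by (intro K) (auto simp: divide_le_eq)
      then show "norm (?G n t) \<le> indicator {0..1} t * (K * \<bar>?h t\<bar>)"
        by (auto simp: indicator_def abs_mult mult_right_mono)
    qed
    show "(\<lambda>t. indicator {0..1} t * (u a * ?h t)) \<in> borel_measurable lborel"
      using borel_measurable_continuous_onI[OF continuous_on_deriv_smooth_step[of UNIV]] by measurable
  qed (use int_G in auto)
  also have "(LBINT t. indicator {0..1} t * (u a * ?h t)) = u a"
    using integral_deriv_smooth_step unfolding set_lebesgue_integral_def
    by (simp add: mult.left_commute)
  finally show "(\<lambda>n. integral\<^sup>L lborel (?F n)) \<longlonglongrightarrow> u a" unfolding eq .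
qed

text \<open>
  Test with \<open>\<psi> n\<close>, the difference of two smooth steps of width \<open>1 / (n + 1)\<close> at \<open>a\<close> and at \<open>b\<close>. It
  tends boundedly to the indicator of \<open>{a<..b}\<close>, while its derivative is a difference of two
  approximate identities, whose integrals against \<open>u\<close> tend to \<open>u a - u b\<close>.
\<close>

lemma weak_derivative_FTC:
  assumes wd: "weak_derivative u g" and u: "continuous_on {0<..} u" and ab: "0 < a" "a < b"
  shows "u b - u a = (LBINT x:{a<..b}. g x)"
proof -
  define \<psi> where "\<psi> n x = smooth_step (real (Suc n) * (x - a)) - smooth_step (real (Suc n) * (x - b))" for n x
  let ?h = "\<lambda>n c x. real (Suc n) * deriv smooth_step (real (Suc n) * (x - c))"
  have deriv_\<psi>: "deriv (\<psi> n) x = ?h n a x - ?h n b x" for n x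
  proof -
    have step: "((\<lambda>x. smooth_step (real (Suc n) * (x - c))) has_real_derivative ?h n c x) (at x)" for c
    proof -
      have "((\<lambda>x. real (Suc n) * (x - c)) has_real_derivative real (Suc n)) (at x)"
        by (auto intro!: derivative_eq_intros)
      from DERIV_chain2[OF DERIV_smooth_step this] show ?thesis by (simp only: mult.commute)
    qed
    show ?thesis unfolding \<psi>_def by (intro DERIV_imp_deriv DERIV_diff step)
  qed
  have test: "test_function (\<psi> n)" for n
    unfolding \<psi>_def using ab by (intro test_function_step_difference) auto
  have lhs: "(\<lambda>n. LBINT x:{0<..}. u x * deriv (\<psi> n) x) \<longlonglongrightarrow> u a - u b"
  proof -
    have "(LBINT x:{0<..}. u x * deriv (\<psi> n) x)
      = (LBINT x. indicator {0<..} x * (u x * ?h n a x)) - (LBINT x. indicator {0<..} x * (u x * ?h n b x))" for n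
      unfolding set_lebesgue_integral_def deriv_\<psi>
      by (subst Bochner_Integration.integral_diff[symmetric])
         (use integral_deriv_scaled_step(1)[OF u] ab in \<open>auto simp: algebra_simps simp del: of_nat_Suc\<close>)
    then show ?thesis
      using tendsto_diff[OF integral_deriv_scaled_step(2)[OF u, of a] integral_deriv_scaled_step(2)[OF u, of b]] ab
      by simp
  qed
  have g: "set_integrable lborel {a..b + 1} g"
    using wd ab unfolding weak_derivative_def locally_integrable_def by auto
  have rhs: "(\<lambda>n. LBINT x:{0<..}. g x * \<psi> n x) \<longlonglongrightarrow> (LBINT x:{a<..b}. g x)"
  proof -
    let ?g = "\<lambda>x. indicator {a..b + 1} x * g x"
    have int_g: "integrable lborel ?g" using g unfolding set_integrable_def by simp
    have eq: "indicator {0<..} x * (g x * \<psi> n x) = ?g x * \<psi> n x" for n x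
    proof (cases "x \<in> {a..b + 1}")
      case True
      with ab show ?thesis by (simp add: indicator_def)
    next
      case False
      then consider "x < a" | "b + 1 < x" by fastforce
      then have "\<psi> n x = 0"
      proof cases
        case 1
        with ab have "real (Suc n) * (x - a) \<le> 0" "real (Suc n) * (x - b) \<le> 0"
          by (simp_all add: mult_le_0_iff)
        then show ?thesis unfolding \<psi>_def by (simp only: smooth_step_0)
      next
        case 2
        with ab have "1 \<le> real (Suc n) * (x - a)" "1 \<le> real (Suc n) * (x - b)"
          using mult_mono[of 1 "real (Suc n)" 1 "x - a"] mult_mono[of 1 "real (Suc n)" 1 "x - b"] by simp_all
        then show ?thesis unfolding \<psi>_def by (simp only: smooth_step_1)
      qed
      then show ?thesis by simp
    qed
    have meas: "\<psi> n \<in> borel_measurable borel" for n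
    proof -
      have "continuous_on UNIV smooth_step"
        using DERIV_smooth_step by (intro continuous_at_imp_continuous_on) (auto dest: DERIV_isCont)
      then have "smooth_step \<in> borel_measurable borel" by (rule borel_measurable_continuous_onI)
      then show ?thesis unfolding \<psi>_def by measurable
    qed
    have "(\<lambda>n. LBINT x. ?g x * \<psi> n x) \<longlonglongrightarrow> (LBINT x. ?g x * indicator {a<..b} x)"
    proof (rule integral_dominated_convergence)
      show "integrable lborel (\<lambda>x. \<bar>?g x\<bar>)" using int_g by simp
      show "AE x in lborel. (\<lambda>n. ?g x * \<psi> n x) \<longlonglongrightarrow> ?g x * indicator {a<..b} x"
      proof (intro AE_I2 tendsto_mult tendsto_const)
        fix x :: real
        have "indicator {a<..} x - indicator {b<..} x = (indicator {a<..b} x :: real)"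
          using ab by (auto simp: indicator_def)
        then show "(\<lambda>n. \<psi> n x) \<longlonglongrightarrow> indicator {a<..b} x"
          unfolding \<psi>_def
          using tendsto_diff[OF smooth_step_scaled_tendsto[of x a] smooth_step_scaled_tendsto[of x b]]
          by simp
      qed
      show "AE x in lborel. norm (?g x * \<psi> n x) \<le> \<bar>?g x\<bar>" for n
      proof (rule AE_I2)
        fix x
        have "\<bar>\<psi> n x\<bar> \<le> 1"
          unfolding \<psi>_def abs_le_iff
          using smooth_step_bounds[of "real (Suc n) * (x - a)"] smooth_step_bounds[of "real (Suc n) * (x - b)"]
          by linarith
        then show "norm (?g x * \<psi> n x) \<le> \<bar>?g x\<bar>"
          by (simp add: abs_mult mult_left_le del: abs_mult_self_eq)
      qed
    qed (use int_g meas in measurable)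
    moreover have "?g x * indicator {a<..b} x = indicator {a<..b} x * g x" for x
      by (auto simp: indicator_def)
    ultimately show ?thesis
      unfolding set_lebesgue_integral_def by (simp add: eq)
  qed
  have "(LBINT x:{0<..}. u x * deriv (\<psi> n) x) = - (LBINT x:{0<..}. g x * \<psi> n x)" for n
    using wd test unfolding weak_derivative_def by blast
  with lhs have "(\<lambda>n. - (LBINT x:{0<..}. g x * \<psi> n x)) \<longlonglongrightarrow> u a - u b" by simp
  from LIMSEQ_unique[OF this tendsto_minus[OF rhs]] show ?thesis by simp
qed

section \<open>Hardy's inequality for tail integrals with exponential weight\<close>

text \<open>
  Cauchy--Schwarz with weight \<open>exp (t / 2)\<close>. Any exponent strictly between 0 and 1 would keep the
  tail of the reciprocal weight finite and leave room for the second integration below; the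
  midpoint gives the least constant, 4.
\<close>

lemma tail_integral_square_le:
  fixes f :: "real \<Rightarrow> real"
  assumes [measurable]: "f \<in> borel_measurable borel"
  shows "(\<integral>\<^sup>+t\<in>{r<..}. ennreal \<bar>f t\<bar> \<partial>lborel)\<^sup>2
    \<le> ennreal (2 * exp (- (r / 2))) * (\<integral>\<^sup>+t\<in>{r<..}. ennreal ((f t)\<^sup>2 * exp (t / 2)) \<partial>lborel)"
proof -
  let ?p = "\<lambda>t. ennreal (exp (- (t / 4))) * indicator {r<..} t"
  let ?q = "\<lambda>t. ennreal (\<bar>f t\<bar> * exp (t / 4)) * indicator {r<..} t"
  have pq: "?p t * ?q t = ennreal \<bar>f t\<bar> * indicator {r<..} t" for t
    by (auto simp: indicator_def simp flip: ennreal_mult exp_add)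
  have p: "(?p t)\<^sup>2 = ennreal (exp (- (t / 2))) * indicator {r<..} t" for t
    by (auto simp: indicator_def ennreal_power simp flip: exp_double)
  have q: "(?q t)\<^sup>2 = ennreal ((f t)\<^sup>2 * exp (t / 2)) * indicator {r<..} t" for t
    by (auto simp: indicator_def ennreal_power power_mult_distrib simp flip: exp_double)
  have "(\<integral>\<^sup>+t. ennreal (exp (- (t / 2))) * indicator {r<..} t \<partial>lborel)
      \<le> (\<integral>\<^sup>+t. ennreal (exp (- (t / 2))) * indicator {r..} t \<partial>lborel)"
    by (intro nn_integral_mono) (auto simp: indicator_def)
  also have "\<dots> = ennreal (0 - (- 2 * exp (- (r / 2))))"
  proof (rule nn_integral_FTC_atLeast)
    show "((\<lambda>x::real. - 2 * exp (- (x / 2))) \<longlongrightarrow> 0) at_top"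
      using tendsto_mult_left[OF filterlim_compose[OF exp_at_bot
        filterlim_uminus_at_bot_at_top[THEN filterlim_compose,
          OF filterlim_tendsto_pos_mult_at_top[OF tendsto_const[of "1 / 2"] _ filterlim_ident]]], of "- 2"]
      by simp
  qed (auto intro!: derivative_eq_intros)
  finally have exp_int: "(\<integral>\<^sup>+t. (?p t)\<^sup>2 \<partial>lborel) \<le> ennreal (2 * exp (- (r / 2)))"
    by (simp add: p)
  have "(\<integral>\<^sup>+t. ?p t * ?q t \<partial>lborel)\<^sup>2 \<le> (\<integral>\<^sup>+t. (?p t)\<^sup>2 \<partial>lborel) * (\<integral>\<^sup>+t. (?q t)\<^sup>2 \<partial>lborel)"
    by (rule Cauchy_Schwarz_nn_integral) measurable
  also have "\<dots> \<le> ennreal (2 * exp (- (r / 2))) * (\<integral>\<^sup>+t. (?q t)\<^sup>2 \<partial>lborel)"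
    by (intro mult_right_mono exp_int) auto
  finally show ?thesis by (simp only: pq q)
qed

text \<open>
  After the preceding estimate, Tonelli's theorem moves the integration over \<open>r\<close> inside, where
  \<open>\<integral>\<^sub>0\<^sup>t 2 exp (r / 2) dr \<le> 4 exp (t / 2)\<close> restores the full weight \<open>exp t\<close>.
\<close>

lemma Hardy_exponential_weight:
  fixes f :: "real \<Rightarrow> real"
  assumes [measurable]: "f \<in> borel_measurable borel"
  shows "(\<integral>\<^sup>+r\<in>{0<..}. (\<integral>\<^sup>+t\<in>{r<..}. ennreal \<bar>f t\<bar> \<partial>lborel)\<^sup>2 * ennreal (exp r) \<partial>lborel)
    \<le> ennreal 4 * (\<integral>\<^sup>+t\<in>{0<..}. ennreal ((f t)\<^sup>2 * exp t) \<partial>lborel)"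
proof -
  let ?w = "\<lambda>t. ennreal ((f t)\<^sup>2 * exp (t / 2))"
  have pw: "(\<integral>\<^sup>+t\<in>{r<..}. ennreal \<bar>f t\<bar> \<partial>lborel)\<^sup>2 * ennreal (exp r)
      \<le> (\<integral>\<^sup>+t. ennreal (2 * exp (r / 2)) * (?w t * indicator {r<..} t) \<partial>lborel)" for r
  proof -
    have "(\<integral>\<^sup>+t\<in>{r<..}. ennreal \<bar>f t\<bar> \<partial>lborel)\<^sup>2 * ennreal (exp r)
        \<le> ennreal (2 * exp (- (r / 2))) * (\<integral>\<^sup>+t\<in>{r<..}. ?w t \<partial>lborel) * ennreal (exp r)"
      by (intro mult_right_mono tail_integral_square_le) auto
    also have "\<dots> = (ennreal (2 * exp (- (r / 2))) * ennreal (exp r)) * (\<integral>\<^sup>+t\<in>{r<..}. ?w t \<partial>lborel)"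
      by (simp only: mult_ac)
    also have "ennreal (2 * exp (- (r / 2))) * ennreal (exp r) = ennreal (2 * exp (r / 2))"
      by (simp flip: ennreal_mult exp_add)
    also have "\<dots> * (\<integral>\<^sup>+t\<in>{r<..}. ?w t \<partial>lborel)
        = (\<integral>\<^sup>+t. ennreal (2 * exp (r / 2)) * (?w t * indicator {r<..} t) \<partial>lborel)"
      by (rule nn_integral_cmult[symmetric]) measurable
    finally show ?thesis .
  qed
  have inner: "(\<integral>\<^sup>+r. ennreal (2 * exp (r / 2)) * indicator {0<..<t} r \<partial>lborel)
      \<le> ennreal (4 * exp (t / 2))" if "0 < t" for t :: real
  proof -
    have "(\<integral>\<^sup>+r. ennreal (2 * exp (r / 2)) * indicator {0<..<t} r \<partial>lborel)
      \<le> (\<integral>\<^sup>+r. ennreal (2 * exp (r / 2)) * indicator {0..t} r \<partial>lborel)"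
      by (intro nn_integral_mono) (auto simp: indicator_def)
    also have "\<dots> = ennreal (4 * exp (t / 2) - 4 * exp (0 / 2))"
      using that by (intro nn_integral_FTC_Icc) (auto intro!: derivative_eq_intros)
    also have "\<dots> \<le> ennreal (4 * exp (t / 2))" by (intro ennreal_leI) simp
    finally show ?thesis .
  qed
  have meas: "(\<lambda>(r, t). ennreal (2 * exp (r / 2)) * (?w t * indicator {r<..} t) * indicator {0<..} r)
      \<in> borel_measurable (lborel \<Otimes>\<^sub>M lborel)"
  proof -
    have "(\<lambda>(r, t). ennreal (2 * exp (r / 2)) * (?w t * (if r < t then 1 else 0)) * indicator {0<..} r)
        \<in> borel_measurable (borel \<Otimes>\<^sub>M borel)"
      by measurable
    then show ?thesis
      by (simp add: indicator_def split_def cong: measurable_cong_sets sets_pair_measure_cong)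
  qed
  have "(\<integral>\<^sup>+r\<in>{0<..}. (\<integral>\<^sup>+t\<in>{r<..}. ennreal \<bar>f t\<bar> \<partial>lborel)\<^sup>2 * ennreal (exp r) \<partial>lborel)
      \<le> (\<integral>\<^sup>+r\<in>{0<..}. (\<integral>\<^sup>+t. ennreal (2 * exp (r / 2)) * (?w t * indicator {r<..} t) \<partial>lborel) \<partial>lborel)"
    by (intro nn_integral_mono mult_right_mono pw) auto
  also have "\<dots> = (\<integral>\<^sup>+r. \<integral>\<^sup>+t. ennreal (2 * exp (r / 2)) * (?w t * indicator {r<..} t) * indicator {0<..} r
      \<partial>lborel \<partial>lborel)"
    by (intro nn_integral_cong nn_integral_multc[symmetric]) measurable
  also have "\<dots> = (\<integral>\<^sup>+t. \<integral>\<^sup>+r. ennreal (2 * exp (r / 2)) * (?w t * indicator {r<..} t) * indicator {0<..} r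
      \<partial>lborel \<partial>lborel)"
    by (rule lborel_pair.Fubini'[symmetric, OF meas])
  also have "\<dots> = (\<integral>\<^sup>+t. \<integral>\<^sup>+r. (?w t * indicator {0<..} t) * (ennreal (2 * exp (r / 2)) * indicator {0<..<t} r)
      \<partial>lborel \<partial>lborel)"
    by (intro nn_integral_cong) (auto simp: indicator_def mult_ac)
  also have "\<dots> = (\<integral>\<^sup>+t. (?w t * indicator {0<..} t) *
      (\<integral>\<^sup>+r. ennreal (2 * exp (r / 2)) * indicator {0<..<t} r \<partial>lborel) \<partial>lborel)"
    by (intro nn_integral_cong nn_integral_cmult) measurable
  also have "\<dots> \<le> (\<integral>\<^sup>+t. ennreal 4 * (ennreal ((f t)\<^sup>2 * exp t) * indicator {0<..} t) \<partial>lborel)"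
  proof (intro nn_integral_mono)
    fix t :: real
    have "?w t * ennreal (4 * exp (t / 2)) = ennreal 4 * ennreal ((f t)\<^sup>2 * exp t)"
      by (simp add: mult_ac flip: exp_add ennreal_mult ennreal_numeral)
    then show "(?w t * indicator {0<..} t) *
        (\<integral>\<^sup>+r. ennreal (2 * exp (r / 2)) * indicator {0<..<t} r \<partial>lborel)
      \<le> ennreal 4 * (ennreal ((f t)\<^sup>2 * exp t) * indicator {0<..} t)"
      using mult_left_mono[OF inner[of t], of "?w t"] by (auto simp: indicator_def)
  qed
  also have "\<dots> = ennreal 4 * (\<integral>\<^sup>+t\<in>{0<..}. ennreal ((f t)\<^sup>2 * exp t) \<partial>lborel)"
    by (rule nn_integral_cmult) measurable
  finally show ?thesis .
qed

section \<open>From tail integrals to functions with a weak derivative\<close>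

text \<open>
  Continuity is absolute continuity for families that consist of one interval.
\<close>

lemma W11_loc_continuous_on:
  assumes "u \<in> W11_loc"
  shows "continuous_on {0<..} u"
proof (intro continuous_at_imp_continuous_on ballI)
  fix x :: real
  assume "x \<in> {0<..}"
  then have x: "0 < x / 2" "x / 2 < x + 1" by auto
  have ac: "abs_continuous_on (x / 2) (x + 1) u" using assms x unfolding W11_loc_def by blast
  show "isCont u x"
    unfolding continuous_at_eps_delta
  proof (intro allI impI)
    fix e :: real
    assume "0 < e"
    then obtain d where "0 < d" and d: "\<And>(n::nat) \<alpha> \<beta>.
        (\<forall>i<n. x / 2 \<le> \<alpha> i \<and> \<alpha> i \<le> \<beta> i \<and> \<beta> i \<le> x + 1) \<Longrightarrow>
        disjoint_family_on (\<lambda>i. {\<alpha> i<..<\<beta> i}) {..<n} \<Longrightarrow>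
        (\<Sum>i<n. \<beta> i - \<alpha> i) < d \<Longrightarrow> (\<Sum>i<n. \<bar>u (\<beta> i) - u (\<alpha> i)\<bar>) < e"
      using ac unfolding abs_continuous_on_def by meson
    have "dist (u y) (u x) < e" if y: "dist y x < min d (min (x / 2) 1)" for y
    proof -
      have "(\<Sum>i<1::nat. \<bar>u (max x y) - u (min x y)\<bar>) < e"
        by (rule d[of 1 "\<lambda>_. min x y" "\<lambda>_. max x y"])
           (use y x in \<open>auto simp: dist_real_def disjoint_family_on_def abs_if split: if_splits\<close>)
      then show ?thesis by (auto simp: dist_real_def max_def min_def split: if_splits)
    qed
    moreover have "0 < min d (min (x / 2) 1)" using \<open>0 < d\<close> x by simp
    ultimately show "\<exists>d>0. \<forall>x'. dist x' x < d \<longrightarrow> dist (u x') (u x) < e" by blast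
  qed
qed

text \<open>
  Local integrability gives measurability on each compact interval only. The intervals
  \<open>[1 / (n + 2), n + 2]\<close> exhaust the half-line; the shift by 2 keeps them nondegenerate for every \<open>n\<close>.
\<close>

lemma locally_integrable_measurable:
  assumes "locally_integrable g"
  shows "(\<lambda>x. indicator {0<..} x * g x) \<in> borel_measurable borel"
proof (rule borel_measurable_LIMSEQ_real)
  fix n :: nat
  have "1 / real (n + 2) < real (n + 2)" by (simp add: field_simps add_pos_nonneg less_1_mult)
  then have "set_integrable lborel {1 / real (n + 2)..real (n + 2)} g"
    using assms unfolding locally_integrable_def by simp
  then show "(\<lambda>x. indicator {1 / real (n + 2)..real (n + 2)} x * g x) \<in> borel_measurable borel"
    unfolding set_integrable_def by (auto dest: borel_measurable_integrable)
next
  fix x :: real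
  have "\<forall>\<^sub>F n in sequentially. indicator {1 / real (n + 2)..real (n + 2)} x * g x = indicator {0<..} x * g x"
  proof (cases "0 < x")
    case True
    obtain N where N: "max x (1 / x) < real N" using reals_Archimedean2 by blast
    have "x \<in> {1 / real (n + 2)..real (n + 2)}" if "N \<le> n" for n
    proof -
      have "1 / x \<le> real (n + 2)" "x \<le> real (n + 2)" using N that by auto
      then show ?thesis using True by (simp add: field_simps)
    qed
    then show ?thesis using True unfolding eventually_sequentially by (intro exI[of _ N]) simp
  next
    case False
    then have "x \<notin> {1 / real (n + 2)..real (n + 2)}" for n
    proof -
      have "0 < 1 / real (n + 2)" by simp
      with False have "x < 1 / real (n + 2)" by linarith
      then show ?thesis by (auto simp del: of_nat_add)
    qed
    then show ?thesis using False by simp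
  qed
  then show "(\<lambda>n. indicator {1 / real (n + 2)..real (n + 2)} x * g x) \<longlonglongrightarrow> indicator {0<..} x * g x"
    by (rule tendsto_eventually)
qed

lemma weak_derivative_increment_le:
  assumes wd: "weak_derivative u g" and u: "continuous_on {0<..} u" and ab: "0 < a" "a < b"
  shows "ennreal \<bar>u b - u a\<bar> \<le> (\<integral>\<^sup>+t\<in>{a<..}. ennreal \<bar>indicator {0<..} t * g t\<bar> \<partial>lborel)"
proof -
  have "ennreal \<bar>u b - u a\<bar> = ennreal (norm (LBINT x. indicator {a<..b} x *\<^sub>R g x))"
    using weak_derivative_FTC[OF wd u ab] unfolding set_lebesgue_integral_def by simp
  also have "\<dots> \<le> (\<integral>\<^sup>+x. ennreal (norm (indicator {a<..b} x *\<^sub>R g x)) \<partial>lborel)"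
  proof (rule integral_norm_bound_ennreal)
    have "set_integrable lborel {a..b} g"
      using wd ab unfolding weak_derivative_def locally_integrable_def by auto
    then show "integrable lborel (\<lambda>x. indicator {a<..b} x *\<^sub>R g x)"
      unfolding set_integrable_def[symmetric] by (rule set_integrable_subset) auto
  qed
  also have "\<dots> \<le> (\<integral>\<^sup>+t\<in>{a<..}. ennreal \<bar>indicator {0<..} t * g t\<bar> \<partial>lborel)"
    using ab by (intro nn_integral_mono) (auto simp: indicator_def)
  finally show ?thesis .
qed

text \<open>
  If \<open>u\<close> vanishes along some sequence tending to infinity, then \<open>\<bar>u r\<bar>\<close> is at most the integral of
  \<open>\<bar>g\<bar>\<close> over the tail beyond \<open>r\<close>, and the Hardy inequality for tail integrals applies.
\<close>

lemma Hardy_exponential_vanishing_at_infinity: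
  fixes R :: "nat \<Rightarrow> real"
  assumes wd: "weak_derivative u g" and u: "continuous_on {0<..} u"
    and R: "filterlim R at_top sequentially" and lim: "(\<lambda>n. u (R n)) \<longlonglongrightarrow> 0"
  shows "(\<integral>\<^sup>+r\<in>{0<..}. ennreal ((u r)\<^sup>2 * exp r) \<partial>lborel)
    \<le> ennreal 4 * (\<integral>\<^sup>+r\<in>{0<..}. ennreal ((g r)\<^sup>2 * exp r) \<partial>lborel)"
proof -
  let ?g = "\<lambda>t. indicator {0<..} t * g t"
  let ?T = "\<lambda>r. \<integral>\<^sup>+t\<in>{r<..}. ennreal \<bar>?g t\<bar> \<partial>lborel"
  have meas: "?g \<in> borel_measurable borel"
    using wd locally_integrable_measurable unfolding weak_derivative_def by blast
  have tail: "ennreal \<bar>u r\<bar> \<le> ?T r" if "0 < r" for r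
  proof (rule tendsto_upperbound)
    have "(\<lambda>n. \<bar>u (R n) - u r\<bar>) \<longlonglongrightarrow> \<bar>0 - u r\<bar>"
      by (intro tendsto_intros lim)
    then show "(\<lambda>n. ennreal \<bar>u (R n) - u r\<bar>) \<longlonglongrightarrow> ennreal \<bar>u r\<bar>"
      by (auto intro: tendsto_ennrealI)
    have "\<forall>\<^sub>F n in sequentially. r < R n"
      using R by (simp add: filterlim_at_top_dense)
    then show "\<forall>\<^sub>F n in sequentially. ennreal \<bar>u (R n) - u r\<bar> \<le> ?T r"
      by eventually_elim (rule weak_derivative_increment_le[OF wd u that])
  qed simp
  have "(\<integral>\<^sup>+r\<in>{0<..}. ennreal ((u r)\<^sup>2 * exp r) \<partial>lborel)
      \<le> (\<integral>\<^sup>+r\<in>{0<..}. (?T r)\<^sup>2 * ennreal (exp r) \<partial>lborel)"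
  proof (intro nn_integral_mono)
    fix r :: real
    have "ennreal ((u r)\<^sup>2 * exp r) = (ennreal \<bar>u r\<bar>)\<^sup>2 * ennreal (exp r)"
      by (simp add: ennreal_mult ennreal_power)
    then show "ennreal ((u r)\<^sup>2 * exp r) * indicator {0<..} r
        \<le> (?T r)\<^sup>2 * ennreal (exp r) * indicator {0<..} r"
      using tail[of r] by (auto simp: indicator_def intro!: mult_right_mono power_mono)
  qed
  also have "\<dots> \<le> ennreal 4 * (\<integral>\<^sup>+t\<in>{0<..}. ennreal ((?g t)\<^sup>2 * exp t) \<partial>lborel)"
    by (rule Hardy_exponential_weight[OF meas])
  also have "(\<integral>\<^sup>+t\<in>{0<..}. ennreal ((?g t)\<^sup>2 * exp t) \<partial>lborel)
      = (\<integral>\<^sup>+r\<in>{0<..}. ennreal ((g r)\<^sup>2 * exp r) \<partial>lborel)"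
    by (intro nn_integral_cong) (auto simp: indicator_def)
  finally show ?thesis .
qed

text \<open>
  Finite energy makes \<open>g\<close> integrable over the whole half-line, by the tail estimate at \<open>r = 0\<close>.
\<close>

lemma bounded_near_0_of_finite_energy:
  assumes wd: "weak_derivative u g" and u: "continuous_on {0<..} u"
    and fin: "(\<integral>\<^sup>+r\<in>{0<..}. ennreal ((g r)\<^sup>2 * exp r) \<partial>lborel) < \<infinity>"
  obtains K where "\<And>s. 0 < s \<Longrightarrow> s < 1 \<Longrightarrow> \<bar>u s\<bar> \<le> K"
proof -
  let ?g = "\<lambda>t. indicator {0<..} t * g t"
  let ?T = "\<lambda>r. \<integral>\<^sup>+t\<in>{r<..}. ennreal \<bar>?g t\<bar> \<partial>lborel"
  have meas: "?g \<in> borel_measurable borel"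
    using wd locally_integrable_measurable unfolding weak_derivative_def by blast
  have "(?T 0)\<^sup>2 \<le> ennreal (2 * exp (- (0 / 2))) * (\<integral>\<^sup>+t\<in>{0<..}. ennreal ((?g t)\<^sup>2 * exp (t / 2)) \<partial>lborel)"
    by (rule tail_integral_square_le[OF meas])
  also have "\<dots> \<le> ennreal 2 * (\<integral>\<^sup>+r\<in>{0<..}. ennreal ((g r)\<^sup>2 * exp r) \<partial>lborel)"
    by (intro mult_mono nn_integral_mono)
       (auto simp: indicator_def intro!: ennreal_leI mult_left_mono)
  also have "\<dots> < \<infinity>" using fin by (simp add: ennreal_mult_less_top)
  finally have "?T 0 \<noteq> \<infinity>" by (auto simp: power2_eq_square)
  then obtain k where k: "0 \<le> k" "?T 0 = ennreal k" by (auto elim: ennreal_cases)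
  have "\<bar>u s\<bar> \<le> \<bar>u 1\<bar> + k" if s: "0 < s" "s < 1" for s
  proof -
    have "ennreal \<bar>u 1 - u s\<bar> \<le> ?T s" by (rule weak_derivative_increment_le[OF wd u s])
    also have "\<dots> \<le> ?T 0" using s by (intro nn_integral_mono) (auto simp: indicator_def)
    finally have "\<bar>u 1 - u s\<bar> \<le> k" using k by simp
    then show ?thesis by linarith
  qed
  then show thesis by (rule that)
qed

section \<open>The Hardy inequality under the sign condition at both ends\<close>

lemma h_fun_exp_weight: "h_fun (\<lambda>_. 1) uminus (\<lambda>x. x\<^sup>2) u r = - (u r)\<^sup>2"
  by (simp add: h_fun_def DERIV_imp_deriv[of uminus "- 1" r] derivative_eq_intros)

text \<open>
  The limit in \<open>R_plus\<close> may be any \<open>l \<ge> 0\<close>, including \<open>\<infinity>\<close>; only the consequence that the sequence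
  eventually exceeds \<open>- 1\<close> matters. With \<open>u\<close> bounded near the origin this bounds
  \<open>(u (R n))\<^sup>2 exp (R n)\<close>, and the growing factor forces \<open>u (R n)\<close> to 0.
\<close>

lemma R_plus_vanishing_at_infinity:
  assumes "u \<in> R_plus (\<lambda>_. 1) uminus (\<lambda>x. x\<^sup>2)" and wd: "weak_derivative u g"
    and fin: "(\<integral>\<^sup>+r\<in>{0<..}. ennreal ((g r)\<^sup>2 * exp r) \<partial>lborel) < \<infinity>"
  obtains R :: "nat \<Rightarrow> real" where "filterlim R at_top sequentially" "(\<lambda>n. u (R n)) \<longlonglongrightarrow> 0"
proof -
  from assms(1) obtain s R :: "nat \<Rightarrow> real" and l :: ereal where uW: "u \<in> W11_loc"
    and s: "\<And>n. 0 < s n" "s \<longlonglongrightarrow> 0" and R: "filterlim R at_top sequentially"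
    and lim: "(\<lambda>n. ereal ((u (s n))\<^sup>2 * exp (s n) - (u (R n))\<^sup>2 * exp (R n))) \<longlonglongrightarrow> l" and l: "0 \<le> l"
    unfolding R_plus_def h_fun_exp_weight by (auto simp: algebra_simps)
  obtain K where K: "\<And>s. 0 < s \<Longrightarrow> s < 1 \<Longrightarrow> \<bar>u s\<bar> \<le> K"
    using bounded_near_0_of_finite_energy[OF wd W11_loc_continuous_on[OF uW] fin] by blast
  have "ereal (- 1) < l" using l by (rule less_le_trans[rotated]) simp
  from order_tendstoD(1)[OF lim this]
  have ev1: "\<forall>\<^sub>F n in sequentially. - 1 < (u (s n))\<^sup>2 * exp (s n) - (u (R n))\<^sup>2 * exp (R n)"
    by simp
  have ev2: "\<forall>\<^sub>F n in sequentially. s n < 1"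
    using order_tendstoD(2)[OF s(2), of 1] by simp
  have bound: "\<forall>\<^sub>F n in sequentially. (u (R n))\<^sup>2 \<le> (K\<^sup>2 * exp 1 + 1) * exp (- R n)"
    using ev1 ev2
  proof eventually_elim
    case (elim n)
    have "(u (s n))\<^sup>2 \<le> K\<^sup>2" using K[OF s(1)[of n]] elim by (simp add: abs_le_square_iff[symmetric])
    then have "(u (s n))\<^sup>2 * exp (s n) \<le> K\<^sup>2 * exp 1" using elim by (intro mult_mono) auto
    with elim have "(u (R n))\<^sup>2 * exp (R n) \<le> K\<^sup>2 * exp 1 + 1" by linarith
    then show ?case by (simp add: exp_minus field_simps)
  qed
  have "(\<lambda>n. (K\<^sup>2 * exp 1 + 1) * exp (- R n)) \<longlonglongrightarrow> (K\<^sup>2 * exp 1 + 1) * 0"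
    using R by (intro tendsto_mult tendsto_const filterlim_compose[OF exp_at_bot]
      filterlim_compose[OF filterlim_uminus_at_bot_at_top])
  then have "(\<lambda>n. (u (R n))\<^sup>2) \<longlonglongrightarrow> 0"
    by (intro tendsto_sandwich[OF _ bound tendsto_const]) auto
  then have "(\<lambda>n. u (R n)) \<longlonglongrightarrow> 0" by (simp add: power_tendsto_0_iff)
  with R show thesis by (rule that)
qed

lemma Hardy_inequality_exp_weight:
  "Hardy_inequality_on (R_plus (\<lambda>_. 1) uminus (\<lambda>x. x\<^sup>2)) (\<lambda>_. 1) uminus (\<lambda>x. x\<^sup>2) 4"
  unfolding Hardy_inequality_on_def
proof (intro ballI allI impI)
  fix u g
  assume u: "u \<in> R_plus (\<lambda>_. 1) uminus (\<lambda>x. x\<^sup>2)" and wd: "weak_derivative u g"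
  let ?E = "\<integral>\<^sup>+r\<in>{0<..}. ennreal ((g r)\<^sup>2 * exp r) \<partial>lborel"
  have "(\<integral>\<^sup>+r\<in>{0<..}. ennreal ((u r)\<^sup>2 * exp r) \<partial>lborel) \<le> ennreal 4 * ?E"
  \<comment> \<open>With infinite energy the right-hand side is infinite.\<close>
  proof (cases "?E < \<infinity>")
    case True
    then obtain R :: "nat \<Rightarrow> real" where "filterlim R at_top sequentially" "(\<lambda>n. u (R n)) \<longlonglongrightarrow> 0"
      using R_plus_vanishing_at_infinity[OF u wd] by blast
    moreover have "continuous_on {0<..} u"
      using u by (intro W11_loc_continuous_on) (auto simp: R_plus_def)
    ultimately show ?thesis
      using Hardy_exponential_vanishing_at_infinity[OF wd] by blast
  next
    case False
    then have "?E = \<infinity>" by (simp add: less_top[symmetric])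
    then show ?thesis by (simp add: ennreal_mult_eq_top_iff)
  qed
  then show "(\<integral>\<^sup>+r\<in>{0<..}. ennreal ((1 * \<bar>u r\<bar>)\<^sup>2 * exp (- (- r))) \<partial>lborel)
      \<le> ennreal 4 * (\<integral>\<^sup>+r\<in>{0<..}. ennreal (\<bar>g r\<bar>\<^sup>2 * exp (- (- r))) \<partial>lborel)"
    by simp
qed

section \<open>Continuously differentiable functions as weakly differentiable functions\<close>

lemma abs_continuous_on_lipschitz:
  assumes "\<And>x y. a \<le> x \<Longrightarrow> x \<le> y \<Longrightarrow> y \<le> b \<Longrightarrow> \<bar>u y - u x\<bar> \<le> K * (y - x)"
  shows "abs_continuous_on a b u"
  unfolding abs_continuous_on_def
proof (intro allI impI)
  fix e :: real
  assume e: "0 < e"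
  show "\<exists>\<delta>>0. \<forall>(n::nat) \<alpha> \<beta>.
        (\<forall>i<n. a \<le> \<alpha> i \<and> \<alpha> i \<le> \<beta> i \<and> \<beta> i \<le> b) \<longrightarrow>
        disjoint_family_on (\<lambda>i. {\<alpha> i<..<\<beta> i}) {..<n} \<longrightarrow>
        (\<Sum>i<n. \<beta> i - \<alpha> i) < \<delta> \<longrightarrow> (\<Sum>i<n. \<bar>u (\<beta> i) - u (\<alpha> i)\<bar>) < e"
  proof (intro exI[of _ "e / (\<bar>K\<bar> + 1)"] conjI allI impI)
    fix n :: nat and \<alpha> \<beta> :: "nat \<Rightarrow> real"
    assume le: "\<forall>i<n. a \<le> \<alpha> i \<and> \<alpha> i \<le> \<beta> i \<and> \<beta> i \<le> b"
      and small: "(\<Sum>i<n. \<beta> i - \<alpha> i) < e / (\<bar>K\<bar> + 1)"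
    have "(\<Sum>i<n. \<bar>u (\<beta> i) - u (\<alpha> i)\<bar>) \<le> (\<Sum>i<n. (\<bar>K\<bar> + 1) * (\<beta> i - \<alpha> i))"
    proof (rule sum_mono)
      fix i
      assume "i \<in> {..<n}"
      then have "\<bar>u (\<beta> i) - u (\<alpha> i)\<bar> \<le> K * (\<beta> i - \<alpha> i)" "0 \<le> \<beta> i - \<alpha> i"
        using le assms by auto
      moreover from this have "K * (\<beta> i - \<alpha> i) \<le> (\<bar>K\<bar> + 1) * (\<beta> i - \<alpha> i)"
        by (intro mult_right_mono) auto
      ultimately show "\<bar>u (\<beta> i) - u (\<alpha> i)\<bar> \<le> (\<bar>K\<bar> + 1) * (\<beta> i - \<alpha> i)" by linarith
    qed
    also have "\<dots> = (\<bar>K\<bar> + 1) * (\<Sum>i<n. \<beta> i - \<alpha> i)" by (simp add: sum_distrib_left)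
    also have "\<dots> < e" using small by (simp add: field_simps add_pos_nonneg)
    finally show "(\<Sum>i<n. \<bar>u (\<beta> i) - u (\<alpha> i)\<bar>) < e" .
  qed (use e in \<open>auto intro!: divide_pos_pos add_nonneg_pos\<close>)
qed

text \<open>
  Integration by parts; the boundary terms vanish because the interval of integration,
  \<open>[a / 2, b + 1]\<close>, is strictly larger than the support \<open>[a, b]\<close> of the test function.
\<close>

lemma C1_weak_derivative:
  assumes D: "\<And>x. 0 < x \<Longrightarrow> (u has_real_derivative g x) (at x)" and g: "continuous_on {0<..} g"
  shows "weak_derivative u g"
  unfolding weak_derivative_def
proof (intro conjI allI impI)
  have u: "continuous_on {0<..} u"
    using D by (intro continuous_at_imp_continuous_on) (auto dest: DERIV_isCont)
  then show "locally_integrable u" "locally_integrable g"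
    unfolding locally_integrable_def using g
    by (auto intro!: borel_integrable_atLeastAtMost' intro: continuous_on_subset)
  fix \<psi>
  assume \<psi>: "test_function \<psi>"
  then obtain a b where ab: "0 < a" "a < b" and supp: "\<And>x. x \<notin> {a..b} \<Longrightarrow> \<psi> x = 0"
    unfolding test_function_def by blast
  have D\<psi>: "(\<psi> has_real_derivative deriv \<psi> x) (at x)" for x
  proof -
    have "((deriv ^^ 0) \<psi>) differentiable (at x)" using \<psi> unfolding test_function_def by blast
    then show ?thesis by (simp add: DERIV_deriv_iff_real_differentiable)
  qed
  have cont_d: "continuous_on A (deriv \<psi>)" for A
  proof (intro continuous_at_imp_continuous_on ballI)
    fix x
    have "((deriv ^^ 1) \<psi>) differentiable (at x)" using \<psi> unfolding test_function_def by blast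
    then show "isCont (deriv \<psi>) x" by (simp add: differentiable_imp_continuous_within)
  qed
  have cont: "continuous_on A \<psi>" for A
    using D\<psi> by (intro continuous_at_imp_continuous_on) (auto dest: DERIV_isCont)
  have supp_d: "deriv \<psi> x = 0" if "x \<notin> {a..b}" for x
  proof -
    have "(\<psi> has_real_derivative 0) (at x)"
      by (rule has_field_derivative_transform_within_open[where f = "\<lambda>_. 0" and S = "- {a..b}"])
         (use that supp in auto)
    then show ?thesis by (rule DERIV_imp_deriv)
  qed
  let ?I = "{a / 2..b + 1}"
  have sub: "continuous_on ?I u" "continuous_on ?I g"
    using u g ab by (auto intro: continuous_on_subset)
  have int: "integrable lborel (\<lambda>x. indicator ?I x *\<^sub>R (u x * deriv \<psi> x))"
     "integrable lborel (\<lambda>x. indicator ?I x *\<^sub>R (g x * \<psi> x))"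
    using borel_integrable_atLeastAtMost'[OF continuous_on_mult[OF sub(1) cont_d]]
      borel_integrable_atLeastAtMost'[OF continuous_on_mult[OF sub(2) cont]]
    unfolding set_integrable_def by auto
  have "(LBINT x. indicator ?I x *\<^sub>R (u x * deriv \<psi> x + g x * \<psi> x)) = u (b + 1) * \<psi> (b + 1) - u (a / 2) * \<psi> (a / 2)"
  proof (rule integral_FTC_atLeastAtMost)
    fix x assume "a / 2 \<le> x" "x \<le> b + 1"
    then have "0 < x" using ab by simp
    then have "((\<lambda>x. u x * \<psi> x) has_real_derivative u x * deriv \<psi> x + g x * \<psi> x) (at x)"
      using DERIV_mult[OF D D\<psi>] by (simp add: algebra_simps)
    then show "((\<lambda>x. u x * \<psi> x) has_vector_derivative u x * deriv \<psi> x + g x * \<psi> x) (at x within ?I)"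
      by (simp add: has_field_derivative_at_within flip: has_real_derivative_iff_has_vector_derivative)
  qed (use ab in \<open>auto intro!: continuous_intros sub cont cont_d\<close>)
  also have "\<dots> = 0" using supp[of "b + 1"] supp[of "a / 2"] ab by simp
  finally have sum_0: "(LBINT x. indicator ?I x *\<^sub>R (u x * deriv \<psi> x)) + (LBINT x. indicator ?I x *\<^sub>R (g x * \<psi> x)) = 0"
    using int by (simp add: algebra_simps flip: Bochner_Integration.integral_add)
  have restrict: "(LBINT x:{0<..}. f x) = (LBINT x. indicator ?I x *\<^sub>R f x)"
    if "\<And>x. x \<notin> {a..b} \<Longrightarrow> f x = 0" for f :: "real \<Rightarrow> real"
    unfolding set_lebesgue_integral_def
  proof (intro Bochner_Integration.integral_cong refl)
    fix x
    show "indicator {0<..} x *\<^sub>R f x = indicator ?I x *\<^sub>R f x"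
      using that[of x] ab by (cases "x \<in> {a..b}") (auto simp: indicator_def)
  qed
  show "(LBINT r:{0<..}. u r * deriv \<psi> r) = - (LBINT r:{0<..}. g r * \<psi> r)"
    using sum_0 by (subst (1 2) restrict) (auto simp: supp supp_d)
qed

section \<open>Failure of the Bloom--Kerman condition\<close>

lemma nn_integral_half_line_infinite:
  fixes f :: "real \<Rightarrow> real"
  assumes "0 < c" and f: "\<And>x. y < x \<Longrightarrow> c \<le> f x"
  shows "(\<integral>\<^sup>+x\<in>{y<..}. ennreal (f x) \<partial>lborel) = \<infinity>"
proof -
  let ?I = "\<integral>\<^sup>+x\<in>{y<..}. ennreal (f x) \<partial>lborel"
  have ge: "ennreal (c * real n) \<le> ?I" for n
  proof -
    have "ennreal (c * real n) = (\<integral>\<^sup>+x. ennreal c * indicator {y<..<y + real n} x \<partial>lborel)"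
      using assms(1) by (simp add: nn_integral_cmult_indicator ennreal_mult)
    also have "\<dots> \<le> ?I"
      using f by (intro nn_integral_mono) (auto simp: indicator_def intro: ennreal_leI)
    finally show ?thesis .
  qed
  show ?thesis
  proof (rule ccontr)
    assume "?I \<noteq> \<infinity>"
    then obtain k where k: "0 \<le> k" "?I = ennreal k"
      by (auto elim: ennreal_cases)
    obtain n where "k / c < real n" using reals_Archimedean2 by blast
    then have "k < c * real n" using assms(1) by (simp add: field_simps)
    moreover have "c * real n \<le> k"
      using ge[of n] k by simp
    ultimately show False by simp
  qed
qed

lemma not_Bloom_Kerman_exp_weight: "\<not> Bloom_Kerman (\<lambda>_. 1) uminus (\<lambda>x. x\<^sup>2) B"
proof -
  have "G_fun (\<lambda>_. 1) uminus (\<lambda>x. x\<^sup>2) 1 1 = \<infinity>"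
    unfolding G_fun_def by (rule nn_integral_half_line_infinite[of 1]) auto
  then show ?thesis
    unfolding Bloom_Kerman_def by (metis less_irrefl zero_less_one)
qed

section \<open>A Hardy transform that violates the inequality\<close>

definition saturating :: "real \<Rightarrow> real" where
  "saturating r = 1 - exp (- r)"

lemma saturating_square_exp_ge: 
  assumes "1 \<le> r"
  shows "1 / 2 \<le> (saturating r)\<^sup>2 * exp r"
proof -
  have "exp (- 1) \<le> (1 / 2 :: real)"
    using exp_ge_add_one_self[of 1] by (simp add: exp_minus field_simps)
  moreover have "exp (- r) \<le> exp (- 1)" using assms by simp
  ultimately have "1 / 2 \<le> saturating r" unfolding saturating_def by linarith
  then have "(1 / 2)\<^sup>2 \<le> (saturating r)\<^sup>2" by (intro power_mono) auto
  moreover have "2 \<le> exp r" using exp_ge_add_one_self[of r] assms by linarith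
  ultimately show ?thesis
    using mult_mono[of "(1/2)\<^sup>2" "(saturating r)\<^sup>2" 2 "exp r"] by (simp add: power2_eq_square)
qed

lemma weak_derivative_saturating: "weak_derivative saturating (\<lambda>r. exp (- r))"
  unfolding saturating_def
  by (rule C1_weak_derivative) (auto intro!: derivative_eq_intros continuous_intros)

lemma saturating_tendsto_0: "(saturating \<longlongrightarrow> 0) (at_right 0)"
proof -
  have "isCont saturating 0" unfolding saturating_def by (intro continuous_intros)
  then have "(saturating \<longlongrightarrow> saturating 0) (at_right 0)"
    by (simp add: continuous_at filterlim_at_split)
  then show ?thesis by (simp add: saturating_def)
qed

lemma saturating_Hardy_transform: "saturating \<in> Hardy_transforms"
proof -
  have "abs_continuous_on a b saturating" if "0 < a" for a b
  proof (rule abs_continuous_on_lipschitz[where K = 1])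
    fix x y :: real
    assume xy: "a \<le> x" "x \<le> y"
    have "exp (- x) - exp (- y) = exp (- x) * (1 - exp (- (y - x)))"
      by (simp add: algebra_simps flip: exp_add)
    also have "\<dots> \<le> 1 * (y - x)"
    proof (rule mult_mono)
      show "1 - exp (- (y - x)) \<le> y - x"
        using exp_ge_add_one_self[of "- (y - x)"] by linarith
    qed (use xy that in auto)
    finally show "\<bar>saturating y - saturating x\<bar> \<le> 1 * (y - x)"
      using xy by (simp add: saturating_def)
  qed
  then show ?thesis
    unfolding Hardy_transforms_def W11_loc_def
    using weak_derivative_saturating saturating_tendsto_0 by blast
qed

text \<open>
  In the expression whose limit is required to be nonnegative, the term at \<open>s n\<close> tends to 0 and
  the term at \<open>R n\<close> is at most \<open>- 1 / 2\<close> as soon as \<open>R n \<ge> 1\<close>.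
\<close>

lemma saturating_not_R_plus: "saturating \<notin> R_plus (\<lambda>_. 1) uminus (\<lambda>x. x\<^sup>2)"
proof
  assume "saturating \<in> R_plus (\<lambda>_. 1) uminus (\<lambda>x. x\<^sup>2)"
  then obtain s R :: "nat \<Rightarrow> real" and l :: ereal where s: "\<And>n. 0 < s n" "s \<longlonglongrightarrow> 0"
    and R: "filterlim R at_top sequentially" and l: "0 \<le> l"
    and lim: "(\<lambda>n. ereal ((saturating (s n))\<^sup>2 * exp (s n) - (saturating (R n))\<^sup>2 * exp (R n))) \<longlonglongrightarrow> l"
    unfolding R_plus_def h_fun_exp_weight by (auto simp: algebra_simps)
  have "(\<lambda>n. (saturating (s n))\<^sup>2 * exp (s n)) \<longlonglongrightarrow> (1 - exp (- 0))\<^sup>2 * exp 0"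
    unfolding saturating_def by (intro tendsto_intros s)
  then have "\<forall>\<^sub>F n in sequentially. (saturating (s n))\<^sup>2 * exp (s n) < 1 / 4"
    by (rule order_tendstoD) simp
  moreover have "\<forall>\<^sub>F n in sequentially. 1 \<le> R n"
    using R by (simp add: filterlim_at_top)
  ultimately have "\<forall>\<^sub>F n in sequentially.
      ereal ((saturating (s n))\<^sup>2 * exp (s n) - (saturating (R n))\<^sup>2 * exp (R n)) \<le> ereal (- (1 / 4))"
    by eventually_elim (use saturating_square_exp_ge in \<open>fastforce\<close>)
  with lim have "l \<le> ereal (- (1 / 4))"
    by (rule tendsto_upperbound) simp
  with l have "(0::ereal) \<le> ereal (- (1 / 4))" by (rule order_trans)
  then show False by simp
qed

lemma no_Hardy_inequality_on_transforms:
  "\<not> Hardy_inequality_on Hardy_transforms (\<lambda>_. 1) uminus (\<lambda>x. x\<^sup>2) C"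
proof
  assume "Hardy_inequality_on Hardy_transforms (\<lambda>_. 1) uminus (\<lambda>x. x\<^sup>2) C"
  then have le: "(\<integral>\<^sup>+r\<in>{0<..}. ennreal ((saturating r)\<^sup>2 * exp r) \<partial>lborel)
      \<le> ennreal C * (\<integral>\<^sup>+r\<in>{0<..}. ennreal ((exp (- r))\<^sup>2 * exp r) \<partial>lborel)"
    using saturating_Hardy_transform weak_derivative_saturating
    unfolding Hardy_inequality_on_def by fastforce
  have "\<infinity> = (\<integral>\<^sup>+r\<in>{1<..}. ennreal ((saturating r)\<^sup>2 * exp r) \<partial>lborel)"
    using nn_integral_half_line_infinite[of "1 / 2" 1 "\<lambda>r. (saturating r)\<^sup>2 * exp r"]
      saturating_square_exp_ge by simp
  also have "\<dots> \<le> (\<integral>\<^sup>+r\<in>{0<..}. ennreal ((saturating r)\<^sup>2 * exp r) \<partial>lborel)"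
    by (intro nn_integral_mono) (auto simp: indicator_def)
  finally have "(\<integral>\<^sup>+r\<in>{0<..}. ennreal ((saturating r)\<^sup>2 * exp r) \<partial>lborel) = \<infinity>"
    by (simp add: top_unique)
  moreover have "(\<integral>\<^sup>+r\<in>{0<..}. ennreal ((exp (- r))\<^sup>2 * exp r) \<partial>lborel) < \<infinity>"
  proof -
    have "(\<integral>\<^sup>+r\<in>{0<..}. ennreal ((exp (- r))\<^sup>2 * exp r) \<partial>lborel)
        \<le> (\<integral>\<^sup>+r. ennreal (exp (- r)) * indicator {0..} r \<partial>lborel)"
      by (intro nn_integral_mono) (auto simp: indicator_def power2_eq_square simp flip: exp_add)
    also have "\<dots> = ennreal (0 - (- exp (- 0)))"
    proof (rule nn_integral_FTC_atLeast)
      show "((\<lambda>r::real. - exp (- r)) \<longlongrightarrow> 0) at_top"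
        using tendsto_minus[OF filterlim_compose[OF exp_at_bot filterlim_uminus_at_bot_at_top]] by simp
    qed (auto intro!: derivative_eq_intros)
    also have "\<dots> < \<infinity>" by simp
    finally show ?thesis .
  qed
  ultimately show False using le by (simp add: ennreal_mult_eq_top_iff top_unique)
qed

section \<open>The quadratic triple with linear potential\<close>

lemma N_function_square: "N_function (\<lambda>x. x\<^sup>2)"
proof -
  have "((\<lambda>x::real. x) \<longlongrightarrow> 0) (at_right 0)" by (rule tendsto_ident_at)
  then have "((\<lambda>x::real. x\<^sup>2 / x) \<longlongrightarrow> 0) (at_right 0)"
    by (rule Lim_transform_eventually) (auto simp: power2_eq_square eventually_at_filter)
  moreover have "filterlim (\<lambda>x::real. x\<^sup>2 / x) at_top at_top"
    by (rule filterlim_cong[THEN iffD1, OF refl refl _ filterlim_ident])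
       (auto simp: power2_eq_square intro: eventually_mono[OF eventually_gt_at_top[of 0]])
  moreover have "convex_on {0..} (\<lambda>x::real. x\<^sup>2)"
    by (rule convex_on_subset[OF convex_power2]) auto
  ultimately show ?thesis
    unfolding N_function_def by (auto intro!: continuous_intros)
qed

lemma deriv_uminus: "deriv uminus = (\<lambda>_::real. - 1 :: real)"
  by (rule ext, rule DERIV_imp_deriv) (auto intro!: derivative_eq_intros)

theorem proposition5p3:
  shows "\<exists>(M :: real \<Rightarrow> real) (d :: real) (D :: real) (\<phi> :: real \<Rightarrow> real) (\<omega> :: real \<Rightarrow> real).
    N_function M \<and> M differentiable_on {0..} \<and>
    1 \<le> d \<and> d \<le> D \<and>
    (\<forall>x>0. d * (M x / x) \<le> deriv M x \<and> deriv M x \<le> D * (M x / x)) \<and>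
    C2_half_line \<phi> \<and> (\<forall>r>0. deriv \<phi> r \<noteq> 0) \<and>
    \<omega> C1_differentiable_on {0<..} \<and> (\<forall>r>0. 0 \<le> \<omega> r) \<and>
    \<comment> \<open>(i)\<close>
    0 < b1 \<omega> \<phi> d D \<and> L_const \<omega> \<phi> < \<infinity> \<and>
    (\<exists>C\<ge>0. Hardy_inequality_on (R_plus \<omega> \<phi> M) \<omega> \<phi> M C) \<and>
    \<comment> \<open>(ii)\<close>
    \<not> (\<exists>B>0. Bloom_Kerman \<omega> \<phi> M B) \<and>
    \<comment> \<open>(iii)\<close>
    R_zero_plus \<omega> \<phi> M \<subset> Hardy_transforms \<and>
    \<not> (\<exists>C\<ge>0. Hardy_inequality_on Hardy_transforms \<omega> \<phi> M C)"
proof (rule exI[of _ "\<lambda>x. x\<^sup>2"], rule exI[of _ 2], rule exI[of _ 2], rule exI[of _ uminus],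
    rule exI[of _ "\<lambda>_. 1"], intro conjI)
  show "N_function (\<lambda>x. x\<^sup>2)" by (rule N_function_square)
  show "(\<lambda>x::real. x\<^sup>2) differentiable_on {0..}"
    by (auto intro!: derivative_intros simp: differentiable_on_def)
  have "deriv (\<lambda>x. x\<^sup>2) x = 2 * x" for x :: real
    by (rule DERIV_imp_deriv) (auto intro!: derivative_eq_intros)
  then show "\<forall>x>0::real. 2 * (x\<^sup>2 / x) \<le> deriv (\<lambda>x. x\<^sup>2) x \<and> deriv (\<lambda>x. x\<^sup>2) x \<le> 2 * (x\<^sup>2 / x)"
    by (simp add: power2_eq_square)
  show "C2_half_line uminus"
    unfolding C2_half_line_def deriv_uminus by (auto simp: C1_differentiable_on_def
      intro!: exI[of _ "\<lambda>_. - 1"] has_vector_derivative_minus has_vector_derivative_id)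
  show "\<forall>r>0::real. deriv uminus r \<noteq> (0::real)" by (simp add: deriv_uminus)
  show "(\<lambda>_::real. 1 :: real) C1_differentiable_on {0<..}" by simp
  show "0 < b1 (\<lambda>_. 1) uminus 2 2"
    by (simp add: b1_def deriv_uminus)
  show "L_const (\<lambda>_. 1) uminus < \<infinity>"
    by (simp add: L_const_def deriv_uminus)
  show "\<exists>C\<ge>0. Hardy_inequality_on (R_plus (\<lambda>_. 1) uminus (\<lambda>x. x\<^sup>2)) (\<lambda>_. 1) uminus (\<lambda>x. x\<^sup>2) C"
    using Hardy_inequality_exp_weight by (intro exI[of _ 4]) simp
  show "\<not> (\<exists>B>0. Bloom_Kerman (\<lambda>_. 1) uminus (\<lambda>x. x\<^sup>2) B)"
    using not_Bloom_Kerman_exp_weight by blast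
  show "R_zero_plus (\<lambda>_. 1) uminus (\<lambda>x. x\<^sup>2) \<subset> Hardy_transforms"
    using saturating_Hardy_transform saturating_not_R_plus unfolding R_zero_plus_def by blast
  show "\<not> (\<exists>C\<ge>0. Hardy_inequality_on Hardy_transforms (\<lambda>_. 1) uminus (\<lambda>x. x\<^sup>2) C)"
    using no_Hardy_inequality_on_transforms by blast
qed auto

end
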